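(* Let $Y$ be a real topological vector space, $D\subset Y$ a non-trivial closed convex pointed cone with $\operatorname{int}D\neq\emptyset$, and $F\subseteq Y$. If $F\subseteq a+\operatorname{int}D$ for some $a\in Y$, then $$\operatorname{WEff}(F,D)=\{y^0\in F\mid\exists k\in\operatorname{int}D:\ \|y^0-a\|_{D,k}=\min_{y\in F}\|y-a\|_{D,k}\}$$ and $$\operatorname{Eff}(F,D)=\{y^0\in F\mid\exists k\in\operatorname{int}D\ \forall y\in F\setminus\{y^0\}:\ \|y^0-a\|_{D,k}<\|y-a\|_{D,k}\}.$$ For $y^0\in\operatorname{WEff}(F,D)$, one can choose $k=y^0-a$, which results in $\|y^0-a\|_{D,k}=1$.
   Context: $\operatorname{Eff}(F,D):=\{y^0\in F\mid F\cap(y^0-D)\subseteq\{y^0\}\}$ and $\operatorname{WEff}(F,D):=\operatorname{Eff}(F,\operatorname{int}D)$. A set $C\subseteq Y$ is a cone if $\mathbb{R}_+C\subseteq C$ with $\mathbb{R}_+=\{x\in\mathbb{R}\mid x\ge0\}$; it is non-trivial if $C\neq\emptyset$, $C\neq\{0\}$, $C\neq Y$; pointed if $C\cap(-C)=\{0\}$. For $k\in\operatorname{int}D$, $\|\cdot\|_{D,k}$ denotes the norm given as the Minkowski functional of the order interval $[-k,k]_D=(-k+D)\cap(k-D)$. *)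

theory Defs
  imports "HOL-Analysis.Analysis"
begin

text \<open>Real topological vector spaces: both operations are jointly continuous, and no
  separation axiom is included.\<close>

class real_topological_vector = real_vector + topological_ab_group_add +
  assumes tendsto_scaleR_Pair:
    "LIM x (nhds c \<times>\<^sub>F nhds v). fst x *\<^sub>R snd x :> nhds (c *\<^sub>R v)"

instance real_normed_vector < real_topological_vector
proof
  fix c :: real and v :: 'a
  have "(fst \<longlongrightarrow> c) (nhds c \<times>\<^sub>F nhds v)" "(snd \<longlongrightarrow> v) (nhds c \<times>\<^sub>F nhds v)"
    by (auto simp: filterlim_fst filterlim_snd)
  then show "LIM x (nhds c \<times>\<^sub>F nhds v). fst x *\<^sub>R snd x :> nhds (c *\<^sub>R v)"
    by (rule tendsto_scaleR)
qed

text \<open>For \<open>D\<close> an arbitrary set, not necessarily a cone: weak efficiency uses \<open>interior D\<close>.\<close>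

definition Eff :: "'a::ab_group_add set \<Rightarrow> 'a set \<Rightarrow> 'a set" where
  "Eff F D = {y0 \<in> F. F \<inter> (\<lambda>d. y0 - d) ` D \<subseteq> {y0}}"

definition WEff :: "'a::{ab_group_add, topological_space} set \<Rightarrow> 'a set \<Rightarrow> 'a set" where
  "WEff F D = Eff F (interior D)"

text \<open>The library's \<^const>\<open>cone\<close> allows the empty set, which is why it is excluded here.\<close>

definition nontrivial_cone :: "'a::real_vector set \<Rightarrow> bool" where
  "nontrivial_cone C \<longleftrightarrow> cone C \<and> C \<noteq> {} \<and> C \<noteq> {0} \<and> C \<noteq> UNIV"

definition pointed :: "'a::ab_group_add set \<Rightarrow> bool" where
  "pointed C \<longleftrightarrow> C \<inter> uminus ` C = {0}"

definition order_interval :: "'a::ab_group_add set \<Rightarrow> 'a \<Rightarrow> 'a \<Rightarrow> 'a set" where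
  "order_interval D u v = (\<lambda>d. u + d) ` D \<inter> (\<lambda>d. v - d) ` D"

text \<open>The infimum is taken in the reals, so this is the Minkowski functional only where the set
  of admissible \<open>t\<close> is nonempty. That holds at every \<open>y\<close> when \<open>A\<close> is a neighbourhood of \<open>0\<close>,
  in particular for the order intervals \<open>[-k, k]\<close> with \<open>k\<close> in the interior of the cone.\<close>

definition minkowski_functional :: "'a::real_vector set \<Rightarrow> 'a \<Rightarrow> real" where
  "minkowski_functional A y = Inf {t. 0 < t \<and> y \<in> (\<lambda>x. t *\<^sub>R x) ` A}"

definition order_norm :: "'a::real_vector set \<Rightarrow> 'a \<Rightarrow> 'a \<Rightarrow> real" where
  "order_norm D k = minkowski_functional (order_interval D (- k) k)"

end

theory Submission
  imports Defs
begin

text \<open>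
  Write \<open>N\<^sub>k\<close> for the norm of the order interval \<open>[-k, k]\<close> with \<open>k \<in> interior D\<close>. On the cone
  \<open>D\<close> itself the lower bound \<open>-t k \<le> y\<close> is automatic, so \<open>N\<^sub>k\<close> only measures how far \<open>k\<close> has to be
  stretched to dominate \<open>y\<close>. This gives two exact translations, for \<open>t > 0\<close> and \<open>y \<in> D\<close>:
  \<open>N\<^sub>k y \<le> t\<close> iff \<open>t k - y \<in> D\<close> (lemma \<open>order_norm_le_iff\<close>, which uses that \<open>D\<close> is closed), and
  \<open>N\<^sub>k y < t\<close> iff \<open>t k - y \<in> interior D\<close> (lemma \<open>order_norm_less_iff\<close>). Since \<open>F - a\<close> lies in
  \<open>interior D\<close>, they apply to every point of \<open>F\<close>.

  With \<open>k = y0 - a\<close> and \<open>t = 1\<close>, the vector \<open>t k - (y - a)\<close> is \<open>y0 - y\<close>. So the unit ball of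
  \<open>N\<^sub>k\<close>, seen from \<open>a\<close>, contains exactly those \<open>y \<in> F\<close> that dominate \<open>y0\<close>, and its open version
  exactly those that dominate \<open>y0\<close> strictly. (Weak) efficiency of \<open>y0\<close> therefore says that \<open>y0\<close>,
  which has norm \<open>1\<close>, is the unique minimiser (a minimiser).

  Conversely, \<open>N\<^sub>k\<close> is monotone on \<open>interior D\<close> with respect to the order of \<open>D\<close>, and strictly monotone with
  respect to that of \<open>interior D\<close>, so that a point dominating \<open>y0\<close> would contradict minimality, for
  whatever \<open>k\<close>. Here \<open>N\<^sub>k (y0 - a) > 0\<close> is needed in order to use the two translations with
  \<open>t = N\<^sub>k (y0 - a)\<close>.
\<close>

section \<open>Lines in a real topological vector space\<close>

text \<open>Continuity of \<open>t \<mapsto> v + t w\<close> at \<open>0\<close>. It lets an interior point be perturbed slightly in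
  any direction, and a limit along a line be taken inside a closed set.\<close>

lemma open_contains_segment:
  fixes v w :: "'a::real_topological_vector"
  assumes "open U" "v \<in> U" "0 < \<delta>"
  obtains e where "0 < e" "e < \<delta>" "v + e *\<^sub>R w \<in> U"
proof -
  have "LIM e (at_right (0::real)). (e, w) :> nhds 0 \<times>\<^sub>F nhds w"
    by (intro filterlim_Pair tendsto_const tendsto_ident_at)
  from filterlim_compose[OF tendsto_scaleR_Pair this]
  have "((\<lambda>e. e *\<^sub>R w) \<longlongrightarrow> 0) (at_right 0)"
    by simp
  then have "((\<lambda>e. v + e *\<^sub>R w) \<longlongrightarrow> v) (at_right 0)"
    using tendsto_add[OF tendsto_const[of v]] by fastforce
  then have "\<forall>\<^sub>F e in at_right 0. v + e *\<^sub>R w \<in> U"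
    using assms by (simp add: tendsto_def)
  moreover have "\<forall>\<^sub>F e in at_right 0. 0 < e \<and> e < \<delta>"
    using eventually_at_right_real[OF \<open>0 < \<delta>\<close>] by simp
  ultimately have "\<forall>\<^sub>F e in at_right 0. 0 < e \<and> e < \<delta> \<and> v + e *\<^sub>R w \<in> U"
    by eventually_elim simp
  then show thesis
    using that eventually_happens'[OF trivial_limit_at_right_real] by blast
qed

lemma closed_contains_endpoint:
  fixes v w :: "'a::real_topological_vector"
  assumes "closed S" "\<And>e. 0 < e \<Longrightarrow> v + e *\<^sub>R w \<in> S"
  shows "v \<in> S"
proof (rule ccontr)
  assume "v \<notin> S"
  then obtain e where "0 < e" "v + e *\<^sub>R w \<in> - S"
    using open_contains_segment[of "- S" v 1 w] assms(1) by (auto simp: open_Compl)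
  then show False
    using assms(2) by auto
qed

lemma continuous_on_scaleR_right:
  fixes S :: "'a::real_topological_vector set"
  shows "continuous_on S (\<lambda>x. c *\<^sub>R x)"
  unfolding continuous_on_def
proof
  fix x
  have "LIM y (at x within S). (c, y) :> nhds c \<times>\<^sub>F nhds x"
    by (intro filterlim_Pair tendsto_const tendsto_ident_at)
  from filterlim_compose[OF tendsto_scaleR_Pair this]
  show "((\<lambda>x. c *\<^sub>R x) \<longlongrightarrow> c *\<^sub>R x) (at x within S)"
    by simp
qed

section \<open>Proper closed convex cones and their interior\<close>

locale proper_closed_convex_cone =
  fixes D :: "'a::real_topological_vector set"
  assumes cone: "cone D" and convex: "convex D" and closed: "closed D"
    and proper: "D \<noteq> UNIV"
begin

lemma scaleR_mem: "x \<in> D \<Longrightarrow> 0 \<le> t \<Longrightarrow> t *\<^sub>R x \<in> D"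
  using cone by (auto simp: cone_def)

lemma add_mem: "x \<in> D \<Longrightarrow> y \<in> D \<Longrightarrow> x + y \<in> D"
  using cone convex convex_cone by blast

lemma interior_subset_cone: "x \<in> interior D \<Longrightarrow> x \<in> D"
  using interior_subset by blast

text \<open>A translate of the open set \<open>interior D\<close> by an element of \<open>D\<close> is open and stays in \<open>D\<close>.\<close>

lemma add_interior_mem:
  assumes "x \<in> interior D" "d \<in> D"
  shows "x + d \<in> interior D"
proof (rule interiorI)
  show "open ((\<lambda>z. z - d) -` interior D)"
    by (intro open_vimage continuous_intros) simp
  show "x + d \<in> (\<lambda>z. z - d) -` interior D"
    using assms by simp
  show "(\<lambda>z. z - d) -` interior D \<subseteq> D"
  proof
    fix z assume "z \<in> (\<lambda>z. z - d) -` interior D"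
    then have "(z - d) + d \<in> D"
      using interior_subset_cone assms(2) by (intro add_mem) auto
    then show "z \<in> D" by simp
  qed
qed

lemma scaleR_interior_mem:
  assumes "x \<in> interior D" "0 < t"
  shows "t *\<^sub>R x \<in> interior D"
proof (rule interiorI)
  show "open ((\<lambda>z. (1 / t) *\<^sub>R z) -` interior D)"
    by (intro open_vimage continuous_on_scaleR_right) simp
  show "t *\<^sub>R x \<in> (\<lambda>z. (1 / t) *\<^sub>R z) -` interior D"
    using assms by simp
  show "(\<lambda>z. (1 / t) *\<^sub>R z) -` interior D \<subseteq> D"
  proof
    fix z assume "z \<in> (\<lambda>z. (1 / t) *\<^sub>R z) -` interior D"
    then have "t *\<^sub>R ((1 / t) *\<^sub>R z) \<in> D"
      using interior_subset_cone assms(2) by (intro scaleR_mem[of "(1 / t) *\<^sub>R z"]) auto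
    then show "z \<in> D" using assms(2) by simp
  qed
qed

text \<open>A cone that is a neighbourhood of \<open>0\<close> absorbs every vector, hence is the whole space.\<close>

lemma zero_notin_interior: "0 \<notin> interior D"
proof
  assume zero: "0 \<in> interior D"
  have "x \<in> D" for x
  proof -
    obtain e where e: "0 < e" "0 + e *\<^sub>R x \<in> interior D"
      using open_contains_segment[OF open_interior zero zero_less_one] by metis
    then have "(1 / e) *\<^sub>R (e *\<^sub>R x) \<in> D"
      using interior_subset_cone by (intro scaleR_mem[of "e *\<^sub>R x"]) auto
    then show ?thesis using e(1) by simp
  qed
  then show False using proper by blast
qed

section \<open>Order norms on the cone\<close>

lemma mem_scaled_order_interval:
  assumes "y \<in> D" "k \<in> D" "0 < t"
  shows "y \<in> (\<lambda>x. t *\<^sub>R x) ` order_interval D (- k) k \<longleftrightarrow> t *\<^sub>R k - y \<in> D"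
proof
  assume "y \<in> (\<lambda>x. t *\<^sub>R x) ` order_interval D (- k) k"
  then obtain d where "d \<in> D" "y = t *\<^sub>R (k - d)"
    by (auto simp: order_interval_def)
  then show "t *\<^sub>R k - y \<in> D"
    using scaleR_mem[of d t] \<open>0 < t\<close> by (simp add: scaleR_diff_right)
next
  assume upper: "t *\<^sub>R k - y \<in> D"
  define x where "x = (1 / t) *\<^sub>R y"
  have y: "y = t *\<^sub>R x" using \<open>0 < t\<close> by (simp add: x_def)
  have "(1 / t) *\<^sub>R (t *\<^sub>R k - y) \<in> D"
    using upper \<open>0 < t\<close> by (intro scaleR_mem) auto
  then have "k - x \<in> D"
    using \<open>0 < t\<close> by (simp add: x_def scaleR_diff_right)
  then have "x \<in> (\<lambda>d. k - d) ` D"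
    by (intro image_eqI[of _ _ "k - x"]) auto
  moreover have "k + x \<in> D"
    using assms by (intro add_mem) (auto simp: x_def intro: scaleR_mem)
  then have "x \<in> (\<lambda>d. - k + d) ` D"
    by (intro image_eqI[of _ _ "k + x"]) auto
  ultimately show "y \<in> (\<lambda>x. t *\<^sub>R x) ` order_interval D (- k) k"
    unfolding order_interval_def y by blast
qed

lemma order_norm_eq_Inf:
  assumes "y \<in> D" "k \<in> interior D"
  shows "order_norm D k y = Inf {t. 0 < t \<and> t *\<^sub>R k - y \<in> D}"
proof -
  have "{t. 0 < t \<and> y \<in> (\<lambda>x. t *\<^sub>R x) ` order_interval D (- k) k} = {t. 0 < t \<and> t *\<^sub>R k - y \<in> D}"
    using mem_scaled_order_interval[OF assms(1) interior_subset_cone[OF assms(2)]] by blast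
  then show ?thesis
    by (simp add: order_norm_def minkowski_functional_def)
qed

text \<open>Interior points are order units, so the infimum is over a nonempty set and is not the
  arbitrary value \<open>Inf {}\<close>.\<close>

lemma order_unit:
  assumes "k \<in> interior D"
  shows "\<exists>t>0. t *\<^sub>R k - y \<in> D"
proof -
  obtain e where e: "0 < e" "k + e *\<^sub>R (- y) \<in> interior D"
    using open_contains_segment[OF open_interior assms zero_less_one] by metis
  then have "(1 / e) *\<^sub>R (k + e *\<^sub>R (- y)) \<in> D"
    using interior_subset_cone by (intro scaleR_mem) auto
  then have "(1 / e) *\<^sub>R k - y \<in> D"
    using e(1) by (simp add: scaleR_diff_right)
  then show ?thesis
    using e(1) by (intro exI[of _ "1 / e"]) simp
qed

lemma order_norm_less_imp:
  assumes "y \<in> D" "k \<in> interior D" "order_norm D k y < t"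
  shows "t *\<^sub>R k - y \<in> interior D"
proof -
  obtain s where s: "s < t" "s *\<^sub>R k - y \<in> D"
    using cInf_lessD[of "{t. 0 < t \<and> t *\<^sub>R k - y \<in> D}" t] assms order_unit[of k y]
    by (auto simp: order_norm_eq_Inf)
  then have "(t - s) *\<^sub>R k + (s *\<^sub>R k - y) \<in> interior D"
    using assms(2) by (intro add_interior_mem scaleR_interior_mem) auto
  then show ?thesis
    by (simp add: scaleR_diff_left)
qed

text \<open>Closedness of \<open>D\<close> makes the infimum attained.\<close>

lemma order_norm_le_imp:
  assumes "y \<in> D" "k \<in> interior D" "order_norm D k y \<le> t"
  shows "t *\<^sub>R k - y \<in> D"
proof (rule closed_contains_endpoint[OF closed])
  fix e :: real assume "0 < e"
  then have "(t + e) *\<^sub>R k - y \<in> interior D"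
    using assms by (intro order_norm_less_imp) auto
  then show "t *\<^sub>R k - y + e *\<^sub>R k \<in> D"
    using interior_subset_cone by (simp add: scaleR_add_left algebra_simps)
qed

lemma order_norm_le_iff:
  assumes "y \<in> D" "k \<in> interior D" "0 < t"
  shows "order_norm D k y \<le> t \<longleftrightarrow> t *\<^sub>R k - y \<in> D"
proof
  assume "t *\<^sub>R k - y \<in> D"
  moreover have "bdd_below {t. 0 < t \<and> t *\<^sub>R k - y \<in> D}"
    by (rule bdd_belowI[of _ 0]) auto
  ultimately show "order_norm D k y \<le> t"
    unfolding order_norm_eq_Inf[OF assms(1,2)] using assms(3) by (intro cInf_lower) auto
qed (rule order_norm_le_imp[OF assms(1,2)])

lemma order_norm_less_iff:
  assumes "y \<in> D" "k \<in> interior D" "0 < t"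
  shows "order_norm D k y < t \<longleftrightarrow> t *\<^sub>R k - y \<in> interior D"
proof
  assume "t *\<^sub>R k - y \<in> interior D"
  then obtain e where e: "0 < e" "e < t" "t *\<^sub>R k - y + e *\<^sub>R (- k) \<in> interior D"
    using open_contains_segment[OF open_interior _ assms(3)] by metis
  then have "(t - e) *\<^sub>R k - y \<in> D"
    using interior_subset_cone by (simp add: scaleR_diff_left algebra_simps)
  then have "order_norm D k y \<le> t - e"
    using assms e by (subst order_norm_le_iff) auto
  then show "order_norm D k y < t"
    using e(1) by simp
qed (rule order_norm_less_imp[OF assms(1,2)])

text \<open>If the norm of an interior point \<open>y\<close> were not positive, then \<open>-y \<in> D\<close>, and
  \<open>0 = y + (-y)\<close> would be interior.\<close>

lemma order_norm_pos:
  assumes "y \<in> interior D" "k \<in> interior D"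
  shows "0 < order_norm D k y"
proof (rule ccontr)
  assume "\<not> 0 < order_norm D k y"
  then have "0 *\<^sub>R k - y \<in> D"
    using assms interior_subset_cone by (intro order_norm_le_imp) auto
  then have "y + (0 *\<^sub>R k - y) \<in> interior D"
    using assms(1) by (intro add_interior_mem)
  then show False
    using zero_notin_interior by simp
qed

lemma order_norm_self:
  assumes "k \<in> interior D"
  shows "order_norm D k k = 1"
  using order_norm_le_iff[of k k 1] order_norm_less_iff[of k k 1] assms
    interior_subset_cone[OF assms] scaleR_mem[of k 0] zero_notin_interior
  by force

text \<open>The two monotonicity properties: at the value \<open>t = N\<^sub>k y\<close> the vector \<open>t k - y\<close> lies in \<open>D\<close>,
  and adding \<open>y - z\<close> to it gives \<open>t k - z\<close>.\<close>

lemma order_norm_mono: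
  assumes "z \<in> interior D" "y \<in> interior D" "k \<in> interior D" "y - z \<in> D"
  shows "order_norm D k z \<le> order_norm D k y"
proof -
  have "(order_norm D k y *\<^sub>R k - y) + (y - z) \<in> D"
    using assms interior_subset_cone by (intro add_mem order_norm_le_imp) auto
  then show ?thesis
    using assms interior_subset_cone order_norm_pos by (subst order_norm_le_iff) auto
qed

lemma order_norm_strict_mono:
  assumes "z \<in> interior D" "y \<in> interior D" "k \<in> interior D" "y - z \<in> interior D"
  shows "order_norm D k z < order_norm D k y"
proof -
  have "(y - z) + (order_norm D k y *\<^sub>R k - y) \<in> interior D"
    using assms interior_subset_cone by (intro add_interior_mem order_norm_le_imp) auto
  then show ?thesis
    using assms interior_subset_cone order_norm_pos by (subst order_norm_less_iff) auto
qed

end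

section \<open>Efficient points as norm minimisers\<close>

lemma Eff_iff: "y0 \<in> Eff F D \<longleftrightarrow> y0 \<in> F \<and> (\<forall>y\<in>F. y0 - y \<in> D \<longrightarrow> y = y0)"
proof -
  have "y \<in> (\<lambda>d. y0 - d) ` D \<longleftrightarrow> y0 - y \<in> D" for y
    by (auto intro: image_eqI[of _ _ "y0 - y"])
  then show ?thesis
    unfolding Eff_def by auto
qed

context proper_closed_convex_cone
begin

lemma WEff_iff: "y0 \<in> WEff F D \<longleftrightarrow> y0 \<in> F \<and> (\<forall>y\<in>F. y0 - y \<notin> interior D)"
  unfolding WEff_def Eff_iff using zero_notin_interior by auto

lemma Eff_subset_WEff: "y0 \<in> Eff F D \<Longrightarrow> y0 \<in> WEff F D"
  unfolding WEff_def Eff_iff using interior_subset_cone by blast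

lemma WEff_imp_minimal:
  assumes "y0 \<in> WEff F D" "y \<in> F" "y0 - a \<in> interior D" "y - a \<in> interior D"
  shows "order_norm D (y0 - a) (y0 - a) \<le> order_norm D (y0 - a) (y - a)"
proof -
  have "\<not> order_norm D (y0 - a) (y - a) < 1"
    using assms interior_subset_cone by (subst order_norm_less_iff) (auto simp: WEff_iff)
  then show ?thesis
    using assms(3) by (simp add: order_norm_self)
qed

lemma Eff_imp_strictly_minimal:
  assumes "y0 \<in> Eff F D" "y \<in> F - {y0}" "y0 - a \<in> interior D" "y - a \<in> interior D"
  shows "order_norm D (y0 - a) (y0 - a) < order_norm D (y0 - a) (y - a)"
proof -
  have "\<not> order_norm D (y0 - a) (y - a) \<le> 1"
    using assms interior_subset_cone by (subst order_norm_le_iff) (auto simp: Eff_iff)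
  then show ?thesis
    using assms(3) by (simp add: order_norm_self)
qed

lemma minimal_imp_WEff:
  assumes "y0 \<in> F" "k \<in> interior D" "\<And>y. y \<in> F \<Longrightarrow> y - a \<in> interior D"
    and "\<forall>y\<in>F. order_norm D k (y0 - a) \<le> order_norm D k (y - a)"
  shows "y0 \<in> WEff F D"
  unfolding WEff_iff
proof (intro conjI ballI notI)
  fix y assume "y \<in> F" "y0 - y \<in> interior D"
  then have "order_norm D k (y - a) < order_norm D k (y0 - a)"
    using assms(1-3) by (intro order_norm_strict_mono) auto
  then show False
    using assms(4) \<open>y \<in> F\<close> by force
qed (rule assms(1))

lemma strictly_minimal_imp_Eff:
  assumes "y0 \<in> F" "k \<in> interior D" "\<And>y. y \<in> F \<Longrightarrow> y - a \<in> interior D"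
    and "\<forall>y\<in>F - {y0}. order_norm D k (y0 - a) < order_norm D k (y - a)"
  shows "y0 \<in> Eff F D"
  unfolding Eff_iff
proof (intro conjI ballI impI)
  fix y assume "y \<in> F" "y0 - y \<in> D"
  then have "order_norm D k (y - a) \<le> order_norm D k (y0 - a)"
    using assms(1-3) by (intro order_norm_mono) auto
  then show "y = y0"
    using assms(4) \<open>y \<in> F\<close> by (meson DiffI leD singletonD)
qed (rule assms(1))

end

theorem theorem12:
  fixes D F :: "'a::real_topological_vector set" and a :: 'a
  assumes "nontrivial_cone D" and "closed D" and "convex D" and "pointed D"
    and "interior D \<noteq> {}"
    and "F \<subseteq> (\<lambda>d. a + d) ` interior D"
  shows "(WEff F D =
      {y0 \<in> F. \<exists>k\<in>interior D. \<forall>y\<in>F. order_norm D k (y0 - a) \<le> order_norm D k (y - a)})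
    \<and> (Eff F D =
      {y0 \<in> F. \<exists>k\<in>interior D. \<forall>y\<in>F - {y0}. order_norm D k (y0 - a) < order_norm D k (y - a)})
    \<and> (\<forall>y0\<in>WEff F D. y0 - a \<in> interior D
      \<and> (\<forall>y\<in>F. order_norm D (y0 - a) (y0 - a) \<le> order_norm D (y0 - a) (y - a))
      \<and> (y0 \<in> Eff F D \<longrightarrow>
          (\<forall>y\<in>F - {y0}. order_norm D (y0 - a) (y0 - a) < order_norm D (y0 - a) (y - a)))
      \<and> order_norm D (y0 - a) (y0 - a) = 1)"
proof -
  interpret proper_closed_convex_cone D
    using assms(1-3) by unfold_locales (auto simp: nontrivial_cone_def)
  have int: "y - a \<in> interior D" if "y \<in> F" for y
    using assms(6) that by auto
  have weff: "y0 \<in> F" "y0 - a \<in> interior D"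
    "\<forall>y\<in>F. order_norm D (y0 - a) (y0 - a) \<le> order_norm D (y0 - a) (y - a)"
    if "y0 \<in> WEff F D" for y0
    using that WEff_imp_minimal[OF that] int by (auto simp: WEff_iff)
  have eff: "\<forall>y\<in>F - {y0}. order_norm D (y0 - a) (y0 - a) < order_norm D (y0 - a) (y - a)"
    if "y0 \<in> Eff F D" for y0
    using that Eff_imp_strictly_minimal[OF that] int by (auto simp: Eff_iff)
  show ?thesis
  proof (intro conjI ballI impI set_eqI iffI)
    fix y0 assume "y0 \<in> WEff F D"
    then show "y0 \<in> {y0 \<in> F. \<exists>k\<in>interior D. \<forall>y\<in>F.
        order_norm D k (y0 - a) \<le> order_norm D k (y - a)}"
      using weff by blast
  next
    fix y0 assume "y0 \<in> {y0 \<in> F. \<exists>k\<in>interior D. \<forall>y\<in>F.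
        order_norm D k (y0 - a) \<le> order_norm D k (y - a)}"
    then show "y0 \<in> WEff F D"
      using minimal_imp_WEff int by blast
  next
    fix y0 assume "y0 \<in> Eff F D"
    then show "y0 \<in> {y0 \<in> F. \<exists>k\<in>interior D. \<forall>y\<in>F - {y0}.
        order_norm D k (y0 - a) < order_norm D k (y - a)}"
      using eff weff Eff_subset_WEff by blast
  next
    fix y0 assume "y0 \<in> {y0 \<in> F. \<exists>k\<in>interior D. \<forall>y\<in>F - {y0}.
        order_norm D k (y0 - a) < order_norm D k (y - a)}"
    then show "y0 \<in> Eff F D"
      using strictly_minimal_imp_Eff int by blast
  qed (use weff eff order_norm_self in blast)+
qed

end
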